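(* Let $1 < p \leq q < \infty$, $p' := p/(p-1)$, and $\alpha < p-1$. Let $X$ be a Banach space with a $q$-Riesz basis $(\phi_k)_{k\in\mathbb{N}}$ of eigenvectors of a strongly continuous semigroup $(\mathbb{T}_t)_{t\ge 0}$ on $X$, $\mathbb{T}_t\phi_k = e^{\lambda_k t}\phi_k$, with $\operatorname{Re}(\lambda_k) < 0$ for all $k \in \mathbb{N}$, and let $B$ be a scalar control operator corresponding to a sequence $(b_k)_{k\in\mathbb{N}}$ of complex numbers. Suppose that there exists $0 < \theta < \pi/2$ such that $$|\operatorname{Im}(-\lambda_k)| < \operatorname{Re}(-\lambda_k) \tan\theta \qquad (\forall k \in \mathbb{N}).$$ Then the control operator $B$ is $L^p_{t^\alpha}$-admissible if and only if there exists a constant $C > 0$ such that $$\sum_{k \in \Gamma} |b_k|^q \leq C \sup_{k \in \Gamma} \left[\operatorname{Re}(-\lambda_k)\right]^{\frac{q}{p'}\left(1 - \frac{\alpha}{p-1}\right)} \qquad (\forall\, \emptyset \neq \Gamma \subset \mathbb{N}),$$ where the right-hand side is $+\infty$ if the supremum is infinite.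
   Context: The sequence $(\phi_k)$ is a Schauder basis of $X$ for which there are constants $c, C > 0$ with $c \sum_k |a_k|^q \leq \left\|\sum_k a_k\phi_k\right\|^q \leq C \sum_k |a_k|^q$ for all $(a_k) \in \ell^q$, so $X$ is identified with $\ell^q$. Let $A$ be the infinitesimal generator of $(\mathbb{T}_t)_{t \geq 0}$; $\mathcal{D}(A^* )'$ denotes the completion of $X$ in the norm $\|x\| := \|(\beta - A)^{-1}x\|_X$ for any fixed $\beta$ in the resolvent set of $A$. A control operator is a bounded linear map $B : \mathbb{C} \to \mathcal{D}(A^* )'$; it corresponds to $(b_k)_{k\in\mathbb{N}}$ in the sense that $B1 = \sum_k b_k\phi_k$ (formally, in $\mathcal{D}(A^* )'$). For a measurable $w : (0,\infty)\to(0,\infty)$, $L^p_w(0,\infty)$ is the space of measurable $u : (0,\infty)\to\mathbb{C}$ with $\|u\|_{L^p_w} := \left(\int_0^\infty |u(t)|^p w(t)\,dt\right)^{1/p} < \infty$; $L^p_{t^\alpha}$ is the case $w(t)=t^\alpha$. $B$ is called $L^p_w$-admissible for $(\mathbb{T}_t)_{t\ge0}$ if there is $m_0 > 0$ such that $$\left\|\int_0^\infty \mathbb{T}_t B u(t)\,dt\right\|_X \leq m_0 \|u\|_{L^p_w(0,\infty)} \qquad (\forall u \in L^p_w(0,\infty)),$$ where $\int_0^\infty \mathbb{T}_t B u(t)\,dt$ is the vector whose $k$-th coordinate with respect to $(\phi_k)$ is $b_k \int_0^\infty e^{\lambda_k t} u(t)\,dt$. *)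

theory Defs
  imports "HOL-Analysis.Analysis"
begin

section \<open>Complex Banach spaces\<close>

class scaleC = scaleR +
  fixes scaleC :: "complex \<Rightarrow> 'a \<Rightarrow> 'a" (infixr "*\<^sub>C" 75)
  assumes scaleR_scaleC: "r *\<^sub>R x = complex_of_real r *\<^sub>C x"

class complex_normed_vector = scaleC + real_normed_vector +
  assumes scaleC_add_right: "a *\<^sub>C (x + y) = a *\<^sub>C x + a *\<^sub>C y"
    and scaleC_add_left: "(a + b) *\<^sub>C x = a *\<^sub>C x + b *\<^sub>C x"
    and scaleC_scaleC: "a *\<^sub>C (b *\<^sub>C x) = (a * b) *\<^sub>C x"
    and scaleC_one: "1 *\<^sub>C x = x"
    and norm_scaleC: "norm (a *\<^sub>C x) = cmod a * norm x"

class complex_banach = complex_normed_vector + complete_space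

subclass (in complex_banach) banach ..

instantiation complex :: complex_banach
begin

definition scaleC_complex :: "complex \<Rightarrow> complex \<Rightarrow> complex"
  where "scaleC_complex a x = a * x"

instance
  by standard (simp_all add: scaleC_complex_def scaleR_conv_of_real algebra_simps norm_mult)

end

definition bounded_clinear :: "('a::complex_normed_vector \<Rightarrow> 'b::complex_normed_vector) \<Rightarrow> bool"
  where "bounded_clinear f \<longleftrightarrow> bounded_linear f \<and> (\<forall>c x. f (c *\<^sub>C x) = c *\<^sub>C f x)"

section \<open>Riesz bases\<close>

definition schauder_basis :: "(nat \<Rightarrow> 'a::complex_banach) \<Rightarrow> bool"
  where "schauder_basis \<phi> \<longleftrightarrow> (\<forall>x. \<exists>!a. (\<lambda>k. a k *\<^sub>C \<phi> k) sums x)"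

definition q_riesz_basis :: "real \<Rightarrow> (nat \<Rightarrow> 'a::complex_banach) \<Rightarrow> bool"
  where "q_riesz_basis q \<phi> \<longleftrightarrow> schauder_basis \<phi> \<and>
    (\<exists>c>0. \<exists>C>0. \<forall>a :: nat \<Rightarrow> complex. summable (\<lambda>k. cmod (a k) powr q) \<longrightarrow>
      summable (\<lambda>k. a k *\<^sub>C \<phi> k) \<and>
      c * (\<Sum>k. cmod (a k) powr q) \<le> norm (\<Sum>k. a k *\<^sub>C \<phi> k) powr q \<and>
      norm (\<Sum>k. a k *\<^sub>C \<phi> k) powr q \<le> C * (\<Sum>k. cmod (a k) powr q))"

section \<open>Strongly continuous semigroups and their generators\<close>

text \<open>A semigroup is a family indexed by all reals, of which only the values at
  nonnegative times are meaningful.\<close>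

definition C0_semigroup :: "(real \<Rightarrow> 'a::complex_banach \<Rightarrow> 'a) \<Rightarrow> bool"
  where "C0_semigroup T \<longleftrightarrow>
    (\<forall>t\<ge>0. bounded_clinear (T t)) \<and>
    (\<forall>x. T 0 x = x) \<and>
    (\<forall>s\<ge>0. \<forall>t\<ge>0. \<forall>x. T (s + t) x = T s (T t x)) \<and>
    (\<forall>x. ((\<lambda>t. T t x) \<longlongrightarrow> x) (at_right 0))"

definition generator_dom :: "(real \<Rightarrow> 'a::complex_banach \<Rightarrow> 'a) \<Rightarrow> 'a set"
  where "generator_dom T = {x. \<exists>y. ((\<lambda>t. (T t x - x) /\<^sub>R t) \<longlongrightarrow> y) (at_right 0)}"

definition generator :: "(real \<Rightarrow> 'a::complex_banach \<Rightarrow> 'a) \<Rightarrow> 'a \<Rightarrow> 'a"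
  where "generator T x = Lim (at_right 0) (\<lambda>t. (T t x - x) /\<^sub>R t)"

text \<open>The operator \<open>(\<beta> - A)\<^sup>-\<^sup>1\<close> for \<open>A\<close> the generator of \<open>T\<close>; only meaningful for
  \<open>\<beta>\<close> in the resolvent set.\<close>

definition resolvent :: "(real \<Rightarrow> 'a::complex_banach \<Rightarrow> 'a) \<Rightarrow> complex \<Rightarrow> 'a \<Rightarrow> 'a"
  where "resolvent T \<beta> = inv_into (generator_dom T) (\<lambda>x. \<beta> *\<^sub>C x - generator T x)"

definition resolvent_set :: "(real \<Rightarrow> 'a::complex_banach \<Rightarrow> 'a) \<Rightarrow> complex set"
  where "resolvent_set T =
    {\<beta>. bij_betw (\<lambda>x. \<beta> *\<^sub>C x - generator T x) (generator_dom T) UNIV \<and>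
        bounded_clinear (resolvent T \<beta>)}"

section \<open>The extrapolation space and control operators\<close>

text \<open>The Banach space \<open>'y\<close>, together with the embedding \<open>J\<close> of \<open>'a\<close>, is a completion of \<open>'a\<close>
  with respect to the norm \<open>x \<mapsto> norm ((\<beta> - A)\<^sup>-\<^sup>1 x)\<close>. Completions are determined up to
  isometric isomorphism only, so the space is described by this property; it is the space
  written \<open>D(A*)'\<close>. Up to equivalence of norms it does not depend on \<open>\<beta>\<close>.\<close>

definition extrapolation_space ::
  "(real \<Rightarrow> 'a::complex_banach \<Rightarrow> 'a) \<Rightarrow> complex \<Rightarrow> ('a \<Rightarrow> 'y::complex_banach) \<Rightarrow> bool"
  where "extrapolation_space T \<beta> J \<longleftrightarrow>
    \<beta> \<in> resolvent_set T \<and>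
    (\<forall>x y. J (x + y) = J x + J y) \<and>
    (\<forall>c x. J (c *\<^sub>C x) = c *\<^sub>C J x) \<and>
    (\<forall>x. norm (J x) = norm (resolvent T \<beta> x)) \<and>
    closure (range J) = UNIV"

definition corresponds_to ::
  "('a::complex_banach \<Rightarrow> 'y::complex_banach) \<Rightarrow> (nat \<Rightarrow> 'a) \<Rightarrow>
    (complex \<Rightarrow> 'y) \<Rightarrow> (nat \<Rightarrow> complex) \<Rightarrow> bool"
  where "corresponds_to J \<phi> B b \<longleftrightarrow> (\<lambda>k. b k *\<^sub>C J (\<phi> k)) sums B 1"

section \<open>Admissibility\<close>

definition weighted_Lp :: "real \<Rightarrow> (real \<Rightarrow> real) \<Rightarrow> (real \<Rightarrow> complex) set"
  where "weighted_Lp p w = {u. u \<in> borel_measurable (lebesgue_on {0<..}) \<and>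
    integrable (lebesgue_on {0<..}) (\<lambda>t. cmod (u t) powr p * w t)}"

definition weighted_Lp_norm :: "real \<Rightarrow> (real \<Rightarrow> real) \<Rightarrow> (real \<Rightarrow> complex) \<Rightarrow> real"
  where "weighted_Lp_norm p w u =
    (LINT t|lebesgue_on {0<..}. cmod (u t) powr p * w t) powr (1 / p)"

text \<open>\<open>has_control_integral \<phi> \<mu> b u x\<close>: the vector \<open>x\<close> is the integral over \<open>(0,\<infinity>)\<close> of
  \<open>T t (B (u t))\<close>, given by its coordinates with respect to \<open>\<phi>\<close>, where
  \<open>T t (\<phi> k) = exp (\<mu> k * t) *\<^sub>C \<phi> k\<close> and \<open>b\<close> is the sequence of coordinates of \<open>B 1\<close>.
  That such an \<open>x\<close> exists means that the integral lies in \<open>X\<close>. Integrability is required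
  explicitly because the Lebesgue integral of a non-integrable function is \<open>0\<close> by convention.\<close>

definition has_control_integral ::
  "(nat \<Rightarrow> 'a::complex_banach) \<Rightarrow> (nat \<Rightarrow> complex) \<Rightarrow> (nat \<Rightarrow> complex) \<Rightarrow>
    (real \<Rightarrow> complex) \<Rightarrow> 'a \<Rightarrow> bool"
  where "has_control_integral \<phi> \<mu> b u x \<longleftrightarrow>
    (\<forall>k. integrable (lebesgue_on {0<..}) (\<lambda>t. exp (\<mu> k * of_real t) * u t)) \<and>
    (\<lambda>k. (b k * (LINT t|lebesgue_on {0<..}. exp (\<mu> k * of_real t) * u t)) *\<^sub>C \<phi> k) sums x"

text \<open>The sequence \<open>b\<close> below is unique when \<open>\<phi>\<close> is a Schauder basis of eigenvectors of the
  semigroup and \<open>J\<close> is the embedding into the extrapolation space.\<close>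

definition Lp_admissible ::
  "(nat \<Rightarrow> 'a::complex_banach) \<Rightarrow> (nat \<Rightarrow> complex) \<Rightarrow> ('a \<Rightarrow> 'y::complex_banach) \<Rightarrow>
    real \<Rightarrow> (real \<Rightarrow> real) \<Rightarrow> (complex \<Rightarrow> 'y) \<Rightarrow> bool"
  where "Lp_admissible \<phi> \<mu> J p w B \<longleftrightarrow>
    (\<exists>b. corresponds_to J \<phi> B b \<and>
      (\<exists>m\<^sub>0>0. \<forall>u\<in>weighted_Lp p w. \<exists>x. has_control_integral \<phi> \<mu> b u x \<and>
        norm x \<le> m\<^sub>0 * weighted_Lp_norm p w u))"

end

theory Submission
  imports Defs
begin

text \<open>
  Put \<open>x\<^sub>k = Re (- \<mu> k)\<close> and \<open>s = q / p * (p - 1 - \<alpha>)\<close>. Both sides are equivalent to the growth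
  bound \<open>(\<Sum>x\<^sub>k \<le> r. \<bar>b\<^sub>k\<bar>\<^sup>q) \<le> C r\<^sup>s\<close> for all \<open>r > 0\<close> (a one-dimensional Carleson condition).

  Sufficiency: let \<open>g x\<close> be the Laplace transform of \<open>v = \<bar>u\<bar>\<close>. For every \<open>d < p - 1\<close>, Hoelder's
  inequality bounds \<open>g(x)\<^sup>p\<close> by a multiple of \<open>x\<close> to the power \<open>d - p + 1\<close> times the integral of
  \<open>exp (- x t) v(t)\<^sup>p t\<^sup>d\<close>. Split \<open>g\<^sup>q\<close> into \<open>g\<^sup>p\<close> and \<open>g\<close> to the power \<open>q - p\<close>, and use
  this with \<open>d = \<alpha> + e\<close> for the first factor, for a small \<open>e > 0\<close>, and with \<open>d = \<alpha>\<close> for the second.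
  The powers of \<open>x\<close> combine to \<open>e - s\<close>. After summation over \<open>k\<close> under the integral, the growth
  bound gives a factor \<open>t\<close> to the power \<open>- e\<close>, which restores the weight \<open>t\<^sup>\<alpha>\<close>.

  Necessity: test with the indicator function of \<open>[D / (2 r), D / r]\<close>. By sectoriality, for
  \<open>D\<close> small depending on \<open>\<theta>\<close> only, the Laplace transform of this function has size of order
  \<open>1 / r\<close> at all \<open>- \<mu> k\<close> with \<open>x\<^sub>k \<le> r\<close>.
\<close>

section \<open>Integrals over the half-line\<close>

abbreviation halfline :: "real measure" where "halfline \<equiv> lebesgue_on {0<..}"

text \<open>This is the bridge to \<open>lborel\<close>, where substitutions are carried out: for a
  Borel integrand, completing the measure changes neither integrability nor the integral.\<close>

lemma has_bochner_integral_halfline_iff: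
  fixes f :: "real \<Rightarrow> real"
  assumes [measurable]: "f \<in> borel_measurable borel"
  shows "has_bochner_integral halfline f i \<longleftrightarrow>
    has_bochner_integral lborel (\<lambda>t. indicator {0<..} t * f t) i"
proof -
  have *: "(\<lambda>t. indicator {0<..} t * f t) \<in> borel_measurable lborel" by measurable
  show ?thesis
    by (subst has_bochner_integral_restrict_space)
      (auto simp: has_bochner_integral_iff integrable_completion[OF *] integral_completion[OF *])
qed

text \<open>For \<open>x = 1\<close> this is Euler's integral for \<open>Gamma a\<close>. Replacing
  \<open>t\<close> by \<open>x * t\<close> gives the general case; the factor
  \<open>x powr (1 - a)\<close> removes the power of \<open>x\<close> that the substitution attaches
  to \<open>t powr (a - 1)\<close>.\<close>

lemma has_bochner_integral_powr_exp:
  fixes a x :: real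
  assumes "a > 0" and "x > 0"
  shows "has_bochner_integral halfline (\<lambda>t. t powr (a - 1) * exp (- (x * t))) (Gamma a / x powr a)"
proof -
  let ?f = "\<lambda>t::real. indicator {0<..} t * (t powr (a - 1) * exp (- t))"
  have "(\<integral>\<^sup>+t. ennreal (?f t) \<partial>lborel) =
      (\<integral>\<^sup>+t. ennreal (indicator {0..} t * t powr (a - 1) / exp t) \<partial>lborel)"
    by (intro nn_integral_cong) (auto split: split_indicator simp: exp_minus field_simps)
  also have "\<dots> = ennreal (Gamma a)"
    using nn_integral_has_integral_lebesgue[OF _ Gamma_integral_real[OF assms(1)]] by simp
  finally have "has_bochner_integral lborel ?f (Gamma a)"
    using Gamma_real_pos[OF assms(1)]
    by (intro has_bochner_integral_nn_integral) auto
  then have "has_bochner_integral lborel (\<lambda>t. ?f (0 + x * t)) (Gamma a /\<^sub>R \<bar>x\<bar>)"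
    using assms(2) by (subst (asm) lborel_has_bochner_integral_real_affine_iff[where c = x and t = 0]) auto
  then have "has_bochner_integral lborel (\<lambda>t. x powr (1 - a) * ?f (0 + x * t))
      (x powr (1 - a) * (Gamma a /\<^sub>R \<bar>x\<bar>))"
    by (intro has_bochner_integral_mult_right) auto
  also have "(\<lambda>t. x powr (1 - a) * ?f (0 + x * t)) =
      (\<lambda>t. indicator {0<..} t * (t powr (a - 1) * exp (- (x * t))))"
    using assms(2)
    by (intro ext) (auto split: split_indicator simp: powr_mult zero_less_mult_iff powr_diff)
  also have "x powr (1 - a) * (Gamma a /\<^sub>R \<bar>x\<bar>) = Gamma a / x powr a"
    using assms(2) by (simp add: powr_diff field_simps)
  finally show ?thesis
    by (subst has_bochner_integral_halfline_iff) auto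
qed

text \<open>Young's inequality alone makes the product integrable. Applied to the factors divided by
  their norms, it gives the bound, because \<open>1 / p + 1 / q = 1\<close>.\<close>

lemma Hoelder_powr:
  fixes f g :: "'a \<Rightarrow> real"
  assumes [measurable]: "f \<in> borel_measurable M" "g \<in> borel_measurable M"
    and nonneg: "\<And>t. 0 \<le> f t" "\<And>t. 0 \<le> g t"
    and pq: "1 < p" "1 < q" "1 / p + 1 / q = 1"
    and f: "integrable M (\<lambda>t. f t powr p)" and g: "integrable M (\<lambda>t. g t powr q)"
  shows "integrable M (\<lambda>t. f t * g t)"
    and "(\<integral>t. f t * g t \<partial>M) \<le> (\<integral>t. f t powr p \<partial>M) powr (1 / p) * (\<integral>t. g t powr q \<partial>M) powr (1 / q)"
proof -
  let ?A = "\<integral>t. f t powr p \<partial>M" and ?B = "\<integral>t. g t powr q \<partial>M"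
  have young: "f t * g t \<le> f t powr p / p + g t powr q / q" for t
    using Youngs_inequality[of p q "f t" "g t"] pq nonneg by auto
  have int: "integrable M (\<lambda>t. f t powr p / p + g t powr q / q)"
    using f g by auto
  show fg: "integrable M (\<lambda>t. f t * g t)"
    by (rule Bochner_Integration.integrable_bound[OF int]) (use young nonneg pq in \<open>auto intro!: AE_I2 order_trans[OF _ abs_ge_self]\<close>)
  have A0: "?A \<ge> 0" and B0: "?B \<ge> 0" by (auto intro: integral_nonneg_AE)
  show "(\<integral>t. f t * g t \<partial>M) \<le> ?A powr (1 / p) * ?B powr (1 / q)"
  proof (cases "?A = 0 \<or> ?B = 0")
    case True
    \<comment> \<open>A factor of norm zero cannot be normalised, but it vanishes almost everywhere,
      and the product with it.\<close>
    have "AE t in M. f t * g t = 0"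
    proof (cases "?A = 0")
      case True
      then have "AE t in M. f t powr p = 0"
        using integral_nonneg_eq_0_iff_AE[OF f] by auto
      then show ?thesis by eventually_elim auto
    next
      case False
      with True have "AE t in M. g t powr q = 0"
        using integral_nonneg_eq_0_iff_AE[OF g] by auto
      then show ?thesis by eventually_elim auto
    qed
    then have "(\<integral>t. f t * g t \<partial>M) = 0"
      by (intro integral_eq_zero_AE)
    then show ?thesis by simp
  next
    case False
    then have A: "?A > 0" and B: "?B > 0" using A0 B0 by (simp_all only: less_le) auto
    let ?a = "?A powr (1 / p)" and ?b = "?B powr (1 / q)"
    have ab: "?a > 0" "?b > 0" using A B by auto
    have "f t * g t \<le> ?a * ?b * (f t powr p / (p * ?A) + g t powr q / (q * ?B))" for t
    proof -
      have "(f t / ?a) * (g t / ?b) \<le> (f t / ?a) powr p / p + (g t / ?b) powr q / q"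
        using Youngs_inequality[of p q "f t / ?a" "g t / ?b"] pq nonneg[of t] ab by auto
      also have "\<dots> = f t powr p / (p * ?A) + g t powr q / (q * ?B)"
        using pq A B nonneg[of t] by (simp add: powr_divide powr_powr mult.commute)
      finally show ?thesis using ab by (simp add: field_simps)
    qed
    then have "(\<integral>t. f t * g t \<partial>M) \<le> (\<integral>t. ?a * ?b * (f t powr p / (p * ?A) + g t powr q / (q * ?B)) \<partial>M)"
      using f g by (intro integral_mono fg) auto
    also have "\<dots> = ?a * ?b * (?A / (p * ?A) + ?B / (q * ?B))"
      using f g by simp
    also have "\<dots> = ?a * ?b"
      using A B pq by simp
    finally show ?thesis .
  qed
qed

lemma measurable_ident_halfline [measurable]: "(\<lambda>t. t) \<in> borel_measurable halfline"
  by (intro measurable_restrict_space1 measurable_completion) auto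

lemma has_bochner_integral_halfline_indicator:
  fixes a b :: real
  assumes "0 < a" and "a \<le> b"
  shows "has_bochner_integral halfline (\<lambda>t. indicator {a..b} t) (b - a)"
proof -
  have "has_bochner_integral lborel (indicator {a..b} :: real \<Rightarrow> real) (measure lborel {a..b})"
    by (rule has_bochner_integral_real_indicator) (use assms in auto)
  also have "(indicator {a..b} :: real \<Rightarrow> real) = (\<lambda>t. indicator {0<..} t * indicator {a..b} t)"
    using assms by (auto split: split_indicator)
  finally show ?thesis
    using assms by (subst has_bochner_integral_halfline_iff) auto
qed

section \<open>Weighted estimates for the Laplace transform\<close>

text \<open>Hoelder's inequality with the exponential shared between both factors and the weight
  \<open>t powr (d / p)\<close> compensated in the second one. The second factor then contributes a
  Gamma integral, and \<open>d < p - 1\<close> is what makes its parameter positive.\<close>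

lemma laplace_transform_powr_le:
  fixes p d x :: real and v :: "real \<Rightarrow> real"
  assumes p: "1 < p" and d: "d < p - 1" and x: "0 < x"
    and [measurable]: "v \<in> borel_measurable halfline" and v: "\<And>t. 0 \<le> v t"
    and int: "integrable halfline (\<lambda>t. exp (- (x * t)) * (v t powr p * t powr d))"
  shows "integrable halfline (\<lambda>t. exp (- (x * t)) * v t)"
    and "(LINT t|halfline. exp (- (x * t)) * v t) powr p \<le>
      Gamma (1 - d / (p - 1)) powr (p - 1) * x powr (d - p + 1) *
        (LINT t|halfline. exp (- (x * t)) * (v t powr p * t powr d))"
proof -
  \<comment> \<open>Here \<open>q\<close> is the exponent conjugate to \<open>p\<close>, not that of
    a Riesz basis. The parameter \<open>a\<close> is chosen so that \<open>?g t powr q\<close> is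
    the integrand of Euler's integral.\<close>
  define q where "q = p / (p - 1)"
  define a where "a = 1 - d / (p - 1)"
  have q: "1 < q" "1 / p + 1 / q = 1" and a: "a > 0"
    using p d by (auto simp: q_def a_def field_simps)
  let ?f = "\<lambda>t. exp (- (x * t)) powr (1 / p) * v t * t powr (d / p)"
  let ?g = "\<lambda>t. exp (- (x * t)) powr (1 / q) * t powr (- (d / p))"
  have f: "?f t powr p = exp (- (x * t)) * (v t powr p * t powr d)" for t
    using p v[of t] by (simp add: powr_mult powr_powr)
  have dq: "- (d / p) * q = a - 1"
    using p by (simp add: a_def q_def field_simps)
  have g: "?g t powr q = t powr (a - 1) * exp (- (x * t))" for t
    using q dq by (simp add: powr_mult powr_powr)
  \<comment> \<open>At \<open>t = 0\<close> the two powers of \<open>t\<close> do not cancel, since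
    \<open>0 powr 0\<close> is \<open>0\<close>.\<close>
  have fg: "?f t * ?g t = exp (- (x * t)) * v t" if "t > 0" for t
  proof -
    have "?f t * ?g t = exp (- (x * t)) powr (1 / p + 1 / q) * v t * t powr (d / p + - (d / p))"
      by (simp only: powr_add mult_ac)
    then show ?thesis using q that by simp
  qed
  have hg: "has_bochner_integral halfline (\<lambda>t. ?g t powr q) (Gamma a / x powr a)"
    unfolding g using a x by (rule has_bochner_integral_powr_exp)
  have meas: "?f \<in> borel_measurable halfline" "?g \<in> borel_measurable halfline"
    by measurable
  note hoelder = Hoelder_powr[OF meas]
  have f_int: "integrable halfline (\<lambda>t. ?f t powr p)"
    unfolding f by (rule int)
  have g_int: "integrable halfline (\<lambda>t. ?g t powr q)"
    using hg by (simp add: has_bochner_integral_iff)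
  have "integrable halfline (\<lambda>t. ?f t * ?g t)"
    using f_int g_int p q v by (intro hoelder(1)) auto
  then show "integrable halfline (\<lambda>t. exp (- (x * t)) * v t)"
    by (rule Bochner_Integration.integrable_cong[THEN iffD1, rotated -1]) (auto simp: fg)
  let ?I = "LINT t|halfline. exp (- (x * t)) * (v t powr p * t powr d)"
  have "(LINT t|halfline. exp (- (x * t)) * v t) = (LINT t|halfline. ?f t * ?g t)"
    by (intro Bochner_Integration.integral_cong) (auto simp: fg)
  also have "\<dots> \<le> (LINT t|halfline. ?f t powr p) powr (1 / p) * (LINT t|halfline. ?g t powr q) powr (1 / q)"
    using f_int g_int p q v by (intro hoelder(2)) auto
  also have "\<dots> = ?I powr (1 / p) * (Gamma a / x powr a) powr (1 / q)"
    unfolding f using hg by (simp add: has_bochner_integral_iff)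
  finally have "(LINT t|halfline. exp (- (x * t)) * v t) powr p \<le>
      (?I powr (1 / p) * (Gamma a / x powr a) powr (1 / q)) powr p"
    using p v by (intro powr_mono2) (auto intro: integral_nonneg_AE)
  also have "\<dots> = ?I * (Gamma a powr (p / q) * x powr (- (a * p / q)))"
  proof -
    have "?I \<ge> 0" by (auto intro: integral_nonneg_AE)
    moreover have "Gamma a / x powr a = Gamma a * x powr (- a)"
      by (simp add: powr_minus divide_inverse)
    ultimately show ?thesis
      using p q x Gamma_real_pos[OF a] by (simp add: powr_mult powr_powr)
  qed
  also have "p / q = p - 1"
    using p by (simp add: q_def)
  also have "- (a * p / q) = d - p + 1"
    using p by (simp add: q_def a_def field_simps)
  finally show "(LINT t|halfline. exp (- (x * t)) * v t) powr p \<le>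
      Gamma (1 - d / (p - 1)) powr (p - 1) * x powr (d - p + 1) * ?I"
    by (simp add: a_def mult_ac)
qed

text \<open>Up to constants, \<open>x\<close> to the power \<open>e - s\<close> times \<open>exp (- x t)\<close> is dominated by the integral of
  \<open>r\<close> to the power \<open>e - s - 1\<close> times \<open>exp (- r t / 2)\<close> over \<open>[x, 2 x]\<close>. Exchanging sum and integral
  brings in the growth bound and leaves a Gamma integral.\<close>

lemma weighted_exp_sum_le:
  fixes c x :: "'i \<Rightarrow> real" and e s C t :: real
  assumes es: "0 < e" "e < s" and t: "0 < t" and F: "finite F"
    and c: "\<And>k. 0 \<le> c k" and x: "\<And>k. 0 < x k"
    and growth: "\<And>r. 0 < r \<Longrightarrow> (\<Sum>k\<in>{k\<in>F. x k \<le> r}. c k) \<le> C * r powr s"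
  shows "(\<Sum>k\<in>F. c k * (x k powr (e - s) * exp (- (x k * t)))) \<le>
    2 powr (1 + s) * C * Gamma e * t powr (- e)"
proof -
  \<comment> \<open>On \<open>[x k, 2 * x k]\<close> one has \<open>r / 2 \<le> x k\<close>, so the
    exponential in \<open>x k * t\<close> is at most the one in \<open>\<tau> * r\<close>.\<close>
  define \<tau> where "\<tau> = t / 2"
  have \<tau>: "\<tau> > 0" using t by (simp add: \<tau>_def)
  define h where "h k r = indicator {x k..2 * x k} r * ((2 * x k) powr (e - s - 1) * exp (- (x k * t)))" for k r
  have h_int: "has_bochner_integral halfline (h k) (2 powr (e - s - 1) * (x k powr (e - s) * exp (- (x k * t))))" for k
  proof -
    have "has_bochner_integral halfline (h k) ((2 * x k - x k) * ((2 * x k) powr (e - s - 1) * exp (- (x k * t))))"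
      unfolding h_def using x[of k]
      by (intro has_bochner_integral_mult_left has_bochner_integral_halfline_indicator) auto
    also have "(2 * x k - x k) * ((2 * x k) powr (e - s - 1) * exp (- (x k * t))) =
        2 powr (e - s - 1) * (x k powr (e - s) * exp (- (x k * t)))"
      using x[of k] powr_add[of "x k" 1 "e - s - 1"] by (simp add: powr_mult)
    finally show ?thesis .
  qed
  \<comment> \<open>The exponent \<open>e - s - 1\<close> is negative, so the power is smallest at
    the right end \<open>2 * x k\<close>. Dropping that end as a restriction on \<open>r\<close>
    leaves \<open>x k \<le> r\<close>, the index condition in \<open>growth\<close>.\<close>
  have h_le: "h k r \<le> (if x k \<le> r then r powr (e - s - 1) * exp (- (\<tau> * r)) else 0)" for k and r :: real
  proof (cases "r \<in> {x k..2 * x k}")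
    case True
    then have "(2 * x k) powr (e - s - 1) \<le> r powr (e - s - 1)"
      using x[of k] es by (intro powr_mono2') auto
    moreover have "exp (- (x k * t)) \<le> exp (- (\<tau> * r))"
      using True t by (auto simp: \<tau>_def mult.commute)
    ultimately show ?thesis
      using True by (auto simp: h_def intro!: mult_mono)
  qed (auto simp: h_def)
  have sum_h: "(\<Sum>k\<in>F. c k * h k r) \<le> C * (r powr (e - 1) * exp (- (\<tau> * r)))" if "r > 0" for r
  proof -
    have "(\<Sum>k\<in>F. c k * h k r) \<le> (\<Sum>k\<in>F. if x k \<le> r then c k * (r powr (e - s - 1) * exp (- (\<tau> * r))) else 0)"
    proof (rule sum_mono)
      fix k
      show "c k * h k r \<le> (if x k \<le> r then c k * (r powr (e - s - 1) * exp (- (\<tau> * r))) else 0)"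
        using mult_left_mono[OF h_le[where k = k and r = r] c[of k]] by (simp split: if_splits)
    qed
    also have "\<dots> = (\<Sum>k\<in>{k\<in>F. x k \<le> r}. c k) * (r powr (e - s - 1) * exp (- (\<tau> * r)))"
      unfolding sum_distrib_right using F by (rule sum.inter_filter[symmetric])
    also have "\<dots> \<le> C * r powr s * (r powr (e - s - 1) * exp (- (\<tau> * r)))"
      using growth[OF that] by (intro mult_right_mono) auto
    also have "\<dots> = C * (r powr (s + (e - s - 1)) * exp (- (\<tau> * r)))"
      unfolding powr_add by (simp only: mult_ac)
    finally show ?thesis by simp
  qed
  have g: "has_bochner_integral halfline (\<lambda>r. r powr (e - 1) * exp (- (\<tau> * r))) (Gamma e / \<tau> powr e)"
    using es \<tau> by (intro has_bochner_integral_powr_exp) auto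
  have lhs: "has_bochner_integral halfline (\<lambda>r. \<Sum>k\<in>F. c k * h k r)
      (\<Sum>k\<in>F. c k * (2 powr (e - s - 1) * (x k powr (e - s) * exp (- (x k * t)))))"
    by (intro has_bochner_integral_sum has_bochner_integral_mult_right h_int)
  have rhs: "has_bochner_integral halfline (\<lambda>r. C * (r powr (e - 1) * exp (- (\<tau> * r))))
      (C * (Gamma e / \<tau> powr e))"
    by (intro has_bochner_integral_mult_right g)
  have "(LINT r|halfline. (\<Sum>k\<in>F. c k * h k r)) \<le>
      (LINT r|halfline. C * (r powr (e - 1) * exp (- (\<tau> * r))))"
    using lhs rhs sum_h by (intro integral_mono) (auto simp: has_bochner_integral_iff)
  then have "(\<Sum>k\<in>F. c k * (2 powr (e - s - 1) * (x k powr (e - s) * exp (- (x k * t))))) \<le>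
      C * (Gamma e / \<tau> powr e)"
    unfolding has_bochner_integral_integral_eq[OF lhs] has_bochner_integral_integral_eq[OF rhs] .
  then have "2 powr (e - s - 1) * (\<Sum>k\<in>F. c k * (x k powr (e - s) * exp (- (x k * t)))) \<le>
      C * (Gamma e / \<tau> powr e)"
    by (simp add: sum_distrib_left mult_ac)
  also have "\<dots> = 2 powr (e - s - 1) * (2 powr (1 + s) * C * Gamma e * t powr (- e))"
  proof -
    have "2 powr (e - s - 1) * (2 powr (1 + s) * C * Gamma e * t powr (- e)) =
        (2 powr (e - s - 1) * 2 powr (1 + s)) * (C * Gamma e * t powr (- e))"
      by (simp only: mult_ac)
    also have "2 powr (e - s - 1) * 2 powr (1 + s) = (2::real) powr e"
      by (simp flip: powr_add)
    finally have "2 powr (e - s - 1) * (2 powr (1 + s) * C * Gamma e * t powr (- e)) =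
        2 powr e * (C * Gamma e * t powr (- e))" .
    moreover have "C * (Gamma e / \<tau> powr e) = 2 powr e * (C * Gamma e * t powr (- e))"
      using t by (simp add: \<tau>_def powr_divide powr_minus field_simps)
    ultimately show ?thesis by (simp only:)
  qed
  finally show ?thesis by simp
qed

text \<open>This is \<open>y \<le> exp y\<close> at \<open>y = x * t / e\<close>, raised to the
  power \<open>e\<close>. It lets the exponential absorb an additional weight
  \<open>t powr e\<close>.\<close>

lemma powr_mult_exp_le:
  fixes e x t :: real
  assumes "0 < e" and "0 < x" and "0 < t"
  shows "t powr e * exp (- (x * t)) \<le> (e / x) powr e"
proof -
  have "x * t / e \<le> exp (x * t / e)"
    using exp_ge_add_one_self[of "x * t / e"] by linarith
  then have "(x * t / e) powr e \<le> exp (x * t / e) powr e"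
    using assms by (intro powr_mono2) auto
  also have "\<dots> = exp (x * t)"
    using assms by (simp add: exp_powr_real)
  finally show ?thesis
    using assms by (simp add: powr_mult powr_divide exp_minus field_simps)
qed

text \<open>\<open>K\<close> is chosen before \<open>v\<close> and \<open>F\<close>. Uniformity in
  \<open>F\<close> is what later yields summability of the coefficients.\<close>

lemma weighted_laplace_bound:
  fixes p q \<alpha> C :: real and c x :: "'i \<Rightarrow> real"
  assumes p: "1 < p" and pq: "p \<le> q" and \<alpha>: "\<alpha> < p - 1" and C: "0 \<le> C"
    and c: "\<And>k. 0 \<le> c k" and x: "\<And>k. 0 < x k"
    and growth: "\<And>F r. finite F \<Longrightarrow> 0 < r \<Longrightarrow>
      (\<Sum>k\<in>{k\<in>F. x k \<le> r}. c k) \<le> C * r powr (q / p * (p - 1 - \<alpha>))"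
  shows "\<exists>K\<ge>0. \<forall>v F. v \<in> borel_measurable halfline \<longrightarrow> (\<forall>t. 0 \<le> v t) \<longrightarrow>
    integrable halfline (\<lambda>t. v t powr p * t powr \<alpha>) \<longrightarrow> finite F \<longrightarrow>
    (\<Sum>k\<in>F. c k * (LINT t|halfline. exp (- (x k * t)) * v t) powr q) \<le>
      K * (LINT t|halfline. v t powr p * t powr \<alpha>) powr (q / p)"
proof -
  define s where "s = q / p * (p - 1 - \<alpha>)"
  \<comment> \<open>Half of the gap between \<open>\<alpha>\<close> and \<open>p - 1\<close>: the
    exponent \<open>\<alpha> + e\<close> stays below \<open>p - 1\<close>, and
    \<open>p \<le> q\<close> gives \<open>s \<ge> 2 * e\<close>, hence \<open>e < s\<close>.\<close>
  define e where "e = (p - 1 - \<alpha>) / 2"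
  have e: "0 < e" "\<alpha> + e < p - 1" using \<alpha> by (auto simp: e_def field_simps)
  have "1 * (p - 1 - \<alpha>) \<le> s"
    unfolding s_def using p pq \<alpha> by (intro mult_right_mono) auto
  then have es: "e < s" using \<alpha> by (simp add: e_def)
  define K\<^sub>1 where "K\<^sub>1 = Gamma (1 - \<alpha> / (p - 1)) powr (p - 1)"
  define K\<^sub>2 where "K\<^sub>2 = Gamma (1 - (\<alpha> + e) / (p - 1)) powr (p - 1)"
  define K\<^sub>3 where "K\<^sub>3 = 2 powr (1 + s) * C * Gamma e"
  define m where "m = (q - p) / p"
  have m: "0 \<le> m" "p * m = q - p" "1 + m = q / p"
    using p pq by (auto simp: m_def field_simps)
  have K3: "K\<^sub>3 \<ge> 0"
    using C Gamma_real_pos[OF e(1)] by (simp add: K\<^sub>3_def)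
  show ?thesis
  proof (intro exI[of _ "K\<^sub>2 * K\<^sub>1 powr m * K\<^sub>3"] conjI allI impI)
    show "0 \<le> K\<^sub>2 * K\<^sub>1 powr m * K\<^sub>3" using K3 by (simp add: K\<^sub>2_def)
  next
    fix v :: "real \<Rightarrow> real" and F :: "'i set"
    assume [measurable]: "v \<in> borel_measurable halfline" and v': "\<forall>t. 0 \<le> v t"
      and int: "integrable halfline (\<lambda>t. v t powr p * t powr \<alpha>)" and F: "finite F"
    have v: "0 \<le> v t" for t using v' by blast
    define N where "N = (LINT t|halfline. v t powr p * t powr \<alpha>)"
    define g where "g k = (LINT t|halfline. exp (- (x k * t)) * v t)" for k
    define I where "I k = (LINT t|halfline. exp (- (x k * t)) * (v t powr p * t powr (\<alpha> + e)))" for k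
    have N: "N \<ge> 0" by (auto simp: N_def intro: integral_nonneg_AE)
    have g: "g k \<ge> 0" for k using v by (auto simp: g_def intro: integral_nonneg_AE)
    have int1: "integrable halfline (\<lambda>t. exp (- (x k * t)) * (v t powr p * t powr \<alpha>))" for k
    proof (rule Bochner_Integration.integrable_bound[OF int])
      show "AE t in halfline. norm (exp (- (x k * t)) * (v t powr p * t powr \<alpha>)) \<le>
          norm (v t powr p * t powr \<alpha>)"
        using x[of k] by (intro AE_I2) (auto intro!: mult_left_le_one_le)
    qed measurable
    \<comment> \<open>With the weight \<open>t powr (\<alpha> + e)\<close> alone integrability could
      fail at infinity, so the exponential is needed. The dependence of the majorant on
      \<open>k\<close> is harmless, as only integrability is at stake.\<close>
    have int2: "integrable halfline (\<lambda>t. exp (- (x k * t)) * (v t powr p * t powr (\<alpha> + e)))" for k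
    proof (rule Bochner_Integration.integrable_bound)
      show "integrable halfline (\<lambda>t. (e / x k) powr e * (v t powr p * t powr \<alpha>))"
        using int by simp
      show "AE t in halfline. norm (exp (- (x k * t)) * (v t powr p * t powr (\<alpha> + e))) \<le>
          norm ((e / x k) powr e * (v t powr p * t powr \<alpha>))"
      proof (rule AE_I2)
        fix t assume "t \<in> space halfline"
        then have "t powr e * exp (- (x k * t)) \<le> (e / x k) powr e"
          using powr_mult_exp_le[OF e(1) x[of k]] by auto
        then have "(t powr e * exp (- (x k * t))) * (v t powr p * t powr \<alpha>) \<le>
            (e / x k) powr e * (v t powr p * t powr \<alpha>)"
          by (intro mult_right_mono) auto
        then show "norm (exp (- (x k * t)) * (v t powr p * t powr (\<alpha> + e))) \<le>
            norm ((e / x k) powr e * (v t powr p * t powr \<alpha>))"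
          by (simp add: powr_add mult_ac)
      qed
    qed measurable
    have g_le: "g k powr q \<le> K\<^sub>2 * K\<^sub>1 powr m * N powr m * (x k powr (e - s) * I k)" for k
    proof -
      have "(LINT t|halfline. exp (- (x k * t)) * (v t powr p * t powr \<alpha>)) \<le> N"
        unfolding N_def
        by (intro integral_mono int1 int) (use x[of k] in \<open>auto intro!: mult_left_le_one_le\<close>)
      then have "K\<^sub>1 * x k powr (\<alpha> - p + 1) *
            (LINT t|halfline. exp (- (x k * t)) * (v t powr p * t powr \<alpha>)) \<le>
          K\<^sub>1 * x k powr (\<alpha> - p + 1) * N"
        by (intro mult_left_mono) (auto simp: K\<^sub>1_def)
      then have 1: "g k powr p \<le> K\<^sub>1 * x k powr (\<alpha> - p + 1) * N"
        using laplace_transform_powr_le(2)[OF p \<alpha> x[of k] _ v int1]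
        unfolding g_def K\<^sub>1_def by fastforce
      have 2: "g k powr p \<le> K\<^sub>2 * x k powr (\<alpha> + e - p + 1) * I k"
        unfolding g_def I_def K\<^sub>2_def
        by (rule laplace_transform_powr_le(2)[OF p e(2) x[of k] _ v int2]) measurable
      have "g k powr q = g k powr (p + p * m)"
        using m by simp
      also have "\<dots> = g k powr p * (g k powr p) powr m"
        by (simp add: powr_add powr_powr)
      \<comment> \<open>The first factor uses the bound \<open>2\<close>, which keeps the
        exponential inside \<open>I k\<close> for the summation over \<open>k\<close>; the second
        uses the bound \<open>1\<close>, where the exponential has been discarded in favour of
        \<open>N\<close>.\<close>
      also have "\<dots> \<le> (K\<^sub>2 * x k powr (\<alpha> + e - p + 1) * I k) * (K\<^sub>1 * x k powr (\<alpha> - p + 1) * N) powr m"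
        using 1 2 m by (intro mult_mono powr_mono2) (auto intro: order_trans[OF _ 2])
      also have "\<dots> = K\<^sub>2 * K\<^sub>1 powr m * N powr m * ((x k powr (\<alpha> + e - p + 1) * x k powr ((\<alpha> - p + 1) * m)) * I k)"
        using N x[of k] by (simp add: powr_mult powr_powr K\<^sub>1_def)
      also have "x k powr (\<alpha> + e - p + 1) * x k powr ((\<alpha> - p + 1) * m) = x k powr (e - s)"
      proof -
        have "\<alpha> + e - p + 1 + (\<alpha> - p + 1) * m = e - (1 + m) * (p - 1 - \<alpha>)"
          by (simp add: algebra_simps)
        then show ?thesis by (simp only: m s_def flip: powr_add)
      qed
      finally show ?thesis .
    qed
    have growth_s: "(\<Sum>k\<in>{k\<in>F. x k \<le> r}. c k) \<le> C * r powr s" if "0 < r" for r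
      unfolding s_def by (rule growth[OF F that])
    \<comment> \<open>With the finite sum under the integral, \<open>t\<close> is fixed and the
      exponentials can be summed pointwise.\<close>
    have "(\<Sum>k\<in>F. c k * (x k powr (e - s) * I k)) =
        (LINT t|halfline. (\<Sum>k\<in>F. c k * (x k powr (e - s) * (exp (- (x k * t)) * (v t powr p * t powr (\<alpha> + e))))))"
      using int2 by (simp add: I_def)
    also have "\<dots> \<le> (LINT t|halfline. K\<^sub>3 * (v t powr p * t powr \<alpha>))"
    proof (rule integral_mono)
      fix t assume "t \<in> space halfline"
      then have t: "t > 0" by simp
      have "(\<Sum>k\<in>F. c k * (x k powr (e - s) * (exp (- (x k * t)) * (v t powr p * t powr (\<alpha> + e))))) =
          (\<Sum>k\<in>F. c k * (x k powr (e - s) * exp (- (x k * t)))) * (v t powr p * t powr (\<alpha> + e))"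
        unfolding sum_distrib_right by (simp only: mult_ac)
      also have "\<dots> \<le> (K\<^sub>3 * t powr (- e)) * (v t powr p * t powr (\<alpha> + e))"
        unfolding K\<^sub>3_def using weighted_exp_sum_le[OF e(1) es t F c x growth_s]
        by (intro mult_right_mono) auto
      also have "\<dots> = K\<^sub>3 * (v t powr p * (t powr (- e) * t powr (\<alpha> + e)))"
        by (simp only: mult_ac)
      also have "t powr (- e) * t powr (\<alpha> + e) = t powr \<alpha>"
        by (simp flip: powr_add)
      finally show "(\<Sum>k\<in>F. c k * (x k powr (e - s) * (exp (- (x k * t)) * (v t powr p * t powr (\<alpha> + e)))))
          \<le> K\<^sub>3 * (v t powr p * t powr \<alpha>)" .
    qed (use int2 int in auto)
    also have "\<dots> = K\<^sub>3 * N" using int by (simp add: N_def)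
    finally have sum_I: "(\<Sum>k\<in>F. c k * (x k powr (e - s) * I k)) \<le> K\<^sub>3 * N" .
    have "(\<Sum>k\<in>F. c k * g k powr q) \<le>
        (\<Sum>k\<in>F. c k * (K\<^sub>2 * K\<^sub>1 powr m * N powr m * (x k powr (e - s) * I k)))"
      by (intro sum_mono mult_left_mono g_le c)
    also have "\<dots> = K\<^sub>2 * K\<^sub>1 powr m * N powr m * (\<Sum>k\<in>F. c k * (x k powr (e - s) * I k))"
      unfolding sum_distrib_left by (simp only: mult_ac)
    also have "\<dots> \<le> K\<^sub>2 * K\<^sub>1 powr m * N powr m * (K\<^sub>3 * N)"
      by (intro mult_left_mono sum_I) (auto simp: K\<^sub>2_def)
    also have "\<dots> = K\<^sub>2 * K\<^sub>1 powr m * K\<^sub>3 * N powr (1 + m)"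
      using N by (simp add: powr_add)
    also have "1 + m = q / p" by (rule m)
    finally show "(\<Sum>k\<in>F. c k * (LINT t|halfline. exp (- (x k * t)) * v t) powr q) \<le>
        K\<^sub>2 * K\<^sub>1 powr m * K\<^sub>3 * (LINT t|halfline. v t powr p * t powr \<alpha>) powr (q / p)"
      by (simp add: g_def N_def)
  qed
qed

section \<open>The Carleson condition in terms of finite sums\<close>

text \<open>The same \<open>C\<close> serves both directions. From left to right, take for
  \<open>\<Gamma>\<close> the indices in \<open>F\<close> with \<open>x k \<le> r\<close>.
  Conversely, take for \<open>r\<close> the \<open>s\<close>-th root of a finite supremum; then all
  of \<open>\<Gamma>\<close> lies below \<open>r\<close>.\<close>

lemma carleson_condition_iff:
  fixes c x :: "'i \<Rightarrow> real" and s :: real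
  assumes c: "\<And>k. 0 \<le> c k" and x: "\<And>k. 0 < x k" and s: "0 < s"
  shows "(\<exists>C>0. \<forall>\<Gamma>. \<Gamma> \<noteq> {} \<longrightarrow>
      (\<Sum>\<^sub>\<infinity>k\<in>\<Gamma>. ennreal (c k)) \<le> ennreal C * (SUP k\<in>\<Gamma>. ennreal (x k powr s))) \<longleftrightarrow>
    (\<exists>C>0. \<forall>F r. finite F \<longrightarrow> 0 < r \<longrightarrow> (\<Sum>k\<in>{k\<in>F. x k \<le> r}. c k) \<le> C * r powr s)"
    (is "(\<exists>C>0. ?P C) \<longleftrightarrow> (\<exists>C>0. ?Q C)")
proof (intro ex_cong1 conj_cong refl iffI)
  fix C :: real
  assume C: "0 < C" and P: "?P C"
  show "?Q C"
  proof (intro allI impI)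
    fix F :: "'i set" and r :: real
    assume F: "finite F" and r: "0 < r"
    define \<Gamma> where "\<Gamma> = {k\<in>F. x k \<le> r}"
    show "(\<Sum>k\<in>{k\<in>F. x k \<le> r}. c k) \<le> C * r powr s"
    proof (cases "\<Gamma> = {}")
      case True
      then show ?thesis using C by (simp add: \<Gamma>_def[symmetric])
    next
      case False
      have "ennreal (\<Sum>k\<in>\<Gamma>. c k) = (\<Sum>\<^sub>\<infinity>k\<in>\<Gamma>. ennreal (c k))"
        using F c by (simp add: \<Gamma>_def)
      also have "\<dots> \<le> ennreal C * (SUP k\<in>\<Gamma>. ennreal (x k powr s))"
        using P False by blast
      also have "\<dots> \<le> ennreal C * ennreal (r powr s)"
        using s x by (intro mult_left_mono SUP_least ennreal_leI powr_mono2) (auto simp: \<Gamma>_def less_imp_le)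
      also have "\<dots> = ennreal (C * r powr s)"
        using C by (simp add: ennreal_mult)
      finally show ?thesis
        using C by (simp add: \<Gamma>_def)
    qed
  qed
next
  fix C :: real
  assume C: "0 < C" and Q: "?Q C"
  show "?P C"
  proof (intro allI impI)
    fix \<Gamma> :: "'i set"
    assume "\<Gamma> \<noteq> {}"
    then obtain k\<^sub>0 where k0: "k\<^sub>0 \<in> \<Gamma>" by blast
    let ?S = "SUP k\<in>\<Gamma>. ennreal (x k powr s)"
    show "(\<Sum>\<^sub>\<infinity>k\<in>\<Gamma>. ennreal (c k)) \<le> ennreal C * ?S"
    proof (cases ?S)
      case top
      \<comment> \<open>Positivity of \<open>C\<close> matters here, because
        \<open>0 * top = 0\<close> in \<open>ennreal\<close>.\<close>
      show ?thesis unfolding top using C by (simp add: ennreal_mult_top)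
    next
      case (real \<sigma>)
      have le: "x k powr s \<le> \<sigma>" if "k \<in> \<Gamma>" for k
        using SUP_upper[OF that, of "\<lambda>k. ennreal (x k powr s)"] real by simp
      \<comment> \<open>A member of \<open>\<Gamma>\<close> makes the supremum positive, so that its
        root is a legitimate radius in \<open>Q\<close>.\<close>
      have "0 < x k\<^sub>0 powr s" using x[of k\<^sub>0] by simp
      with le[OF k0] have \<sigma>: "0 < \<sigma>" by linarith
      define r where "r = \<sigma> powr (1 / s)"
      have r: "0 < r" "r powr s = \<sigma>" using \<sigma> s by (auto simp: r_def powr_powr)
      have x_le: "x k \<le> r" if "k \<in> \<Gamma>" for k
      proof (rule ccontr)
        assume "\<not> x k \<le> r"
        then have "r powr s < x k powr s" using r s by (intro powr_less_mono2) auto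
        with le[OF that] r show False by simp
      qed
      show ?thesis
      proof (rule infsum_le_finite_sums)
        show "(\<lambda>k. ennreal (c k)) summable_on \<Gamma>"
          by (rule nonneg_summable_on_complete) simp
        fix F assume F: "finite F" "F \<subseteq> \<Gamma>"
        then have "{k\<in>F. x k \<le> r} = F" using x_le by auto
        then have "(\<Sum>k\<in>F. c k) \<le> C * \<sigma>" using Q F r by metis
        then show "(\<Sum>k\<in>F. ennreal (c k)) \<le> ennreal C * ?S"
          using c C real by (simp add: ennreal_leI ennreal_mult'[symmetric])
      qed
    qed
  qed
qed

section \<open>Riesz bases and control operators\<close>

lemma scaleC_zero_left [simp]: "0 *\<^sub>C (x :: 'a::complex_normed_vector) = 0"
  using norm_scaleC[of 0 x] by simp

lemma scaleC_zero_right [simp]: "a *\<^sub>C (0 :: 'a::complex_normed_vector) = 0"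
  using norm_scaleC[of a "0 :: 'a"] by simp

lemma scaleC_diff_left: "(a - b) *\<^sub>C (x :: 'a::complex_normed_vector) = a *\<^sub>C x - b *\<^sub>C x"
  using scaleC_add_left[of "a - b" b x] by simp

lemma schauder_basis_coeff_unique:
  assumes "schauder_basis \<phi>" and "(\<lambda>k. a k *\<^sub>C \<phi> k) sums x" and "(\<lambda>k. a' k *\<^sub>C \<phi> k) sums x"
  shows "a = a'"
  using assms unfolding schauder_basis_def by blast

text \<open>A vanishing basis vector would give \<open>0\<close> a second expansion.\<close>

lemma schauder_basis_nonzero:
  assumes "schauder_basis \<phi>"
  shows "\<phi> k \<noteq> 0"
proof
  assume "\<phi> k = 0"
  then have "(\<lambda>j. (if j = k then 1 else 0) *\<^sub>C \<phi> j) = (\<lambda>j. 0)" by auto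
  then have "(\<lambda>j. (if j = k then 1 else 0) *\<^sub>C \<phi> j) sums 0"
    by (simp only: sums_zero)
  moreover have "(\<lambda>j. 0 *\<^sub>C \<phi> j) sums 0" by simp
  ultimately have "(\<lambda>j. if j = k then 1 else 0) = (\<lambda>j. 0 :: complex)"
    by (rule schauder_basis_coeff_unique[OF assms])
  from fun_cong[OF this, of k] show False by simp
qed

lemma generator_eigenvector:
  fixes T :: "real \<Rightarrow> 'a::complex_banach \<Rightarrow> 'a"
  assumes "\<And>t. t \<ge> 0 \<Longrightarrow> T t x = exp (\<nu> * of_real t) *\<^sub>C x"
  shows "x \<in> generator_dom T" and "generator T x = \<nu> *\<^sub>C x"
proof -
  have "((\<lambda>z. exp (\<nu> * z)) has_field_derivative \<nu>) (at 0)"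
    by (auto intro!: derivative_eq_intros)
  then have "((\<lambda>z. (exp (\<nu> * z) - 1) / z) \<longlongrightarrow> \<nu>) (at 0)"
    by (simp add: has_field_derivative_iff)
  \<comment> \<open>The complex derivative of the exponential at \<open>0\<close> is restricted to
    positive real times; \<open>norm_scaleC\<close> then carries the scalar limit over to
    vectors.\<close>
  moreover have "filterlim (complex_of_real :: real \<Rightarrow> complex) (at 0) (at_right 0)"
    unfolding filterlim_at
    by (auto intro!: tendsto_eq_intros simp: eventually_at_filter)
  ultimately have lim: "((\<lambda>t. (exp (\<nu> * of_real t) - 1) / of_real t) \<longlongrightarrow> \<nu>) (at_right (0::real))"
    by (rule filterlim_compose)
  have "((\<lambda>t. (exp (\<nu> * of_real t) - 1) / of_real t - \<nu>) \<longlongrightarrow> 0) (at_right (0::real))"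
    using lim unfolding LIM_zero_iff .
  then have "((\<lambda>t. cmod ((exp (\<nu> * of_real t) - 1) / of_real t - \<nu>) * norm x) \<longlongrightarrow> 0) (at_right (0::real))"
    by (intro tendsto_mult_left_zero tendsto_norm_zero)
  then have "((\<lambda>t. ((exp (\<nu> * of_real t) - 1) / of_real t) *\<^sub>C x - \<nu> *\<^sub>C x) \<longlongrightarrow> 0) (at_right (0::real))"
    unfolding norm_scaleC[symmetric] scaleC_diff_left by (rule tendsto_norm_zero_cancel)
  then have lim': "((\<lambda>t. ((exp (\<nu> * of_real t) - 1) / of_real t) *\<^sub>C x) \<longlongrightarrow> \<nu> *\<^sub>C x) (at_right (0::real))"
    unfolding LIM_zero_iff .
  have eq: "((exp (\<nu> * of_real t) - 1) / of_real t) *\<^sub>C x = (T t x - x) /\<^sub>R t" if "t > 0" for t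
  proof -
    have "(T t x - x) /\<^sub>R t = of_real (inverse t) *\<^sub>C ((exp (\<nu> * of_real t) - 1) *\<^sub>C x)"
      using that assms[of t] by (simp add: scaleR_scaleC scaleC_diff_left scaleC_one)
    then show ?thesis by (simp add: scaleC_scaleC divide_inverse mult.commute)
  qed
  have "((\<lambda>t. (T t x - x) /\<^sub>R t) \<longlongrightarrow> \<nu> *\<^sub>C x) (at_right 0)"
    by (rule Lim_transform_eventually[OF lim']) (auto simp: eventually_at_filter eq)
  then show "x \<in> generator_dom T" and "generator T x = \<nu> *\<^sub>C x"
    by (auto simp: generator_dom_def generator_def intro: tendsto_Lim)
qed

text \<open>Applying the resolvent to \<open>\<beta> *\<^sub>C x - generator T x = (\<beta> - \<nu>)
  *\<^sub>C x\<close> returns \<open>x\<close>; as \<open>x\<close> is nonzero, so is the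
  scalar.\<close>

lemma resolvent_eigenvector:
  fixes T :: "real \<Rightarrow> 'a::complex_banach \<Rightarrow> 'a"
  assumes T: "\<And>t. t \<ge> 0 \<Longrightarrow> T t x = exp (\<nu> * of_real t) *\<^sub>C x"
    and x: "x \<noteq> 0" and \<beta>: "\<beta> \<in> resolvent_set T"
  shows "\<beta> \<noteq> \<nu>" and "resolvent T \<beta> x = inverse (\<beta> - \<nu>) *\<^sub>C x"
proof -
  have lin: "resolvent T \<beta> (a *\<^sub>C y) = a *\<^sub>C resolvent T \<beta> y" for a y
    using \<beta> by (auto simp: resolvent_set_def bounded_clinear_def)
  have inj: "inj_on (\<lambda>x. \<beta> *\<^sub>C x - generator T x) (generator_dom T)"
    using \<beta> by (auto simp: resolvent_set_def bij_betw_def)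
  have "resolvent T \<beta> (\<beta> *\<^sub>C x - generator T x) = x"
    unfolding resolvent_def using inv_into_f_f[OF inj generator_eigenvector(1)[where T = T and x = x and \<nu> = \<nu>, OF T]] by simp
  then have eq: "(\<beta> - \<nu>) *\<^sub>C resolvent T \<beta> x = x"
    by (simp add: generator_eigenvector(2)[where T = T and x = x and \<nu> = \<nu>, OF T] lin flip: scaleC_diff_left)
  with x show "\<beta> \<noteq> \<nu>" by auto
  then have "resolvent T \<beta> x = inverse (\<beta> - \<nu>) *\<^sub>C ((\<beta> - \<nu>) *\<^sub>C resolvent T \<beta> x)"
    by (simp add: scaleC_scaleC scaleC_one)
  then show "resolvent T \<beta> x = inverse (\<beta> - \<nu>) *\<^sub>C x"
    by (simp add: eq)
qed

text \<open>\<open>Lp_admissible\<close> quantifies over the sequence representing \<open>B\<close>,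
  so it has to be shown that only one exists. The resolvent turns a null expansion in the
  extrapolation space into one in the original space, with coefficients multiplied by the nonzero
  numbers \<open>inverse (\<beta> - \<mu> k)\<close>.\<close>

lemma corresponds_to_unique:
  fixes T :: "real \<Rightarrow> 'a::complex_banach \<Rightarrow> 'a" and J :: "'a \<Rightarrow> 'y::complex_banach"
  assumes \<phi>: "schauder_basis \<phi>"
    and T: "\<And>k t. t \<ge> 0 \<Longrightarrow> T t (\<phi> k) = exp (\<mu> k * of_real t) *\<^sub>C \<phi> k"
    and J: "extrapolation_space T \<beta> J"
    and b: "corresponds_to J \<phi> B b" and b': "corresponds_to J \<phi> B b'"
  shows "b = b'"
proof -
  have \<beta>: "\<beta> \<in> resolvent_set T" and J_add: "\<And>x y. J (x + y) = J x + J y"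
    and J_scale: "\<And>c x. J (c *\<^sub>C x) = c *\<^sub>C J x"
    and J_norm: "\<And>x. norm (J x) = norm (resolvent T \<beta> x)"
    using J by (auto simp: extrapolation_space_def)
  have R: "bounded_clinear (resolvent T \<beta>)"
    using \<beta> by (auto simp: resolvent_set_def)
  have J_zero: "J 0 = 0" using J_add[of 0 0] by simp
  have J_sum: "J (\<Sum>k<n. f k) = (\<Sum>k<n. J (f k))" for f :: "nat \<Rightarrow> 'a" and n
    by (induction n) (simp_all add: J_zero J_add)
  have R_sum: "resolvent T \<beta> (\<Sum>k<n. f k) = (\<Sum>k<n. resolvent T \<beta> (f k))" for f :: "nat \<Rightarrow> 'a" and n
    using R by (auto simp: bounded_clinear_def linear_sum bounded_linear.linear)
  have R_scale: "resolvent T \<beta> (c *\<^sub>C x) = c *\<^sub>C resolvent T \<beta> x" for c x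
    using R by (auto simp: bounded_clinear_def)
  have eig: "\<beta> \<noteq> \<mu> k" "resolvent T \<beta> (\<phi> k) = inverse (\<beta> - \<mu> k) *\<^sub>C \<phi> k" for k
    using resolvent_eigenvector[where T = T and x = "\<phi> k" and \<nu> = "\<mu> k", OF T schauder_basis_nonzero[OF \<phi>] \<beta>]
    by auto
  let ?d = "\<lambda>k. b k - b' k"
  have "(\<lambda>k. ?d k *\<^sub>C J (\<phi> k)) sums (B 1 - B 1)"
    using sums_diff[OF b[unfolded corresponds_to_def] b'[unfolded corresponds_to_def]]
    by (simp add: scaleC_diff_left)
  then have "(\<lambda>n. norm (\<Sum>k<n. ?d k *\<^sub>C J (\<phi> k))) \<longlonglongrightarrow> 0"
    unfolding sums_def by (auto intro: tendsto_norm_zero)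
  also have "(\<lambda>n. norm (\<Sum>k<n. ?d k *\<^sub>C J (\<phi> k))) =
      (\<lambda>n. norm (\<Sum>k<n. (?d k * inverse (\<beta> - \<mu> k)) *\<^sub>C \<phi> k))"
  proof
    fix n
    have "norm (\<Sum>k<n. ?d k *\<^sub>C J (\<phi> k)) = norm (J (\<Sum>k<n. ?d k *\<^sub>C \<phi> k))"
      by (simp add: J_sum J_scale)
    also have "\<dots> = norm (\<Sum>k<n. (?d k * inverse (\<beta> - \<mu> k)) *\<^sub>C \<phi> k)"
      by (simp add: J_norm R_sum R_scale eig(2) scaleC_scaleC)
    finally show "norm (\<Sum>k<n. ?d k *\<^sub>C J (\<phi> k)) =
        norm (\<Sum>k<n. (?d k * inverse (\<beta> - \<mu> k)) *\<^sub>C \<phi> k)" .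
  qed
  finally have "(\<lambda>k. (?d k * inverse (\<beta> - \<mu> k)) *\<^sub>C \<phi> k) sums 0"
    unfolding sums_def by (rule tendsto_norm_zero_cancel)
  moreover have "(\<lambda>k. 0 *\<^sub>C \<phi> k) sums 0" by simp
  ultimately have "(\<lambda>k. ?d k * inverse (\<beta> - \<mu> k)) = (\<lambda>k. 0)"
    by (rule schauder_basis_coeff_unique[OF \<phi>])
  then have "?d k * inverse (\<beta> - \<mu> k) = 0" for k by (rule fun_cong)
  moreover have "\<beta> \<noteq> \<mu> k" for k by (rule eig(1))
  ultimately show "b = b'" by (intro ext) auto
qed

text \<open>The lower Riesz bound is assumed for coefficients in \<open>\<ell>\<^sup>q\<close> only; applied to the partial sums
  of a convergent expansion it shows that all coefficient sequences are of this kind.\<close>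

lemma q_riesz_basis_lower:
  fixes \<phi> :: "nat \<Rightarrow> 'a::complex_banach"
  assumes "q_riesz_basis q \<phi>" and q: "0 < q"
  shows "\<exists>c>0. \<forall>a x n. (\<lambda>k. a k *\<^sub>C \<phi> k) sums x \<longrightarrow>
    c * (\<Sum>k<n. cmod (a k) powr q) \<le> norm x powr q"
proof -
  obtain c where c: "c > 0" and low: "\<And>a :: nat \<Rightarrow> complex. summable (\<lambda>k. cmod (a k) powr q) \<Longrightarrow>
      c * (\<Sum>k. cmod (a k) powr q) \<le> norm (\<Sum>k. a k *\<^sub>C \<phi> k) powr q"
    using assms unfolding q_riesz_basis_def by blast
  show ?thesis
  proof (intro exI[of _ c] conjI allI impI c)
    fix a :: "nat \<Rightarrow> complex" and x n
    assume sums: "(\<lambda>k. a k *\<^sub>C \<phi> k) sums x"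
    let ?S = "\<lambda>n. \<Sum>k<n. a k *\<^sub>C \<phi> k"
    have partial: "c * (\<Sum>k<n. cmod (a k) powr q) \<le> norm (?S n) powr q" for n
    proof -
      \<comment> \<open>The truncated sequence has finite support, so the lower bound applies to it
        without knowing that \<open>a\<close> lies in the sequence space.\<close>
      let ?a = "\<lambda>k. if k < n then a k else 0"
      have 1: "(\<lambda>k. cmod (?a k) powr q) sums (\<Sum>k<n. cmod (?a k) powr q)"
        by (rule sums_finite) auto
      have 2: "(\<lambda>k. ?a k *\<^sub>C \<phi> k) sums (\<Sum>k<n. ?a k *\<^sub>C \<phi> k)"
        by (rule sums_finite) auto
      show ?thesis
        using low[OF sums_summable[OF 1]] sums_unique[OF 1] sums_unique[OF 2] by simp
    qed
    have "?S \<longlonglongrightarrow> x" using sums by (simp add: sums_def)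
    then have "Bseq ?S" by (intro convergent_imp_Bseq convergentI)
    then obtain K where K: "K > 0" "\<And>n. norm (?S n) \<le> K" by (auto elim: BseqE)
    have sum: "summable (\<lambda>k. cmod (a k) powr q)"
    proof (rule summableI_nonneg_bounded)
      fix n
      have "norm (?S n) powr q \<le> K powr q"
        using K q by (intro powr_mono2) auto
      with partial[of n] have "c * (\<Sum>k<n. cmod (a k) powr q) \<le> K powr q" by linarith
      then show "(\<Sum>k<n. cmod (a k) powr q) \<le> K powr q / c"
        using c by (simp add: field_simps)
    qed simp
    have "c * (\<Sum>k<n. cmod (a k) powr q) \<le> c * (\<Sum>k. cmod (a k) powr q)"
      using c by (intro mult_left_mono sum_le_suminf[OF sum]) auto
    also have "\<dots> \<le> norm x powr q"
      using low[OF sum] sums_unique[OF sums] by simp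
    finally show "c * (\<Sum>k<n. cmod (a k) powr q) \<le> norm x powr q" .
  qed
qed

section \<open>Admissibility\<close>

text \<open>The modulus is bounded below by the real part. On the interval
  \<open>R * t \<le> D\<close>, so the sector condition and the choice of \<open>D\<close> keep the
  phase \<open>Im \<nu> * t\<close> within \<open>pi / 3\<close>, where the cosine is at least
  \<open>1 / 2\<close>, and the exponential is at least \<open>exp (- D)\<close>. The interval has
  length \<open>D / (2 * R)\<close>.\<close>

lemma cmod_laplace_indicator_ge:
  fixes \<nu> :: complex and \<theta> D R :: real
  assumes \<theta>: "0 < \<theta>" "\<theta> < pi / 2" and D: "D = pi / (3 * tan \<theta>)" and R: "0 < R"
    and \<nu>: "Re \<nu> < 0" "- Re \<nu> \<le> R" "\<bar>Im \<nu>\<bar> \<le> - Re \<nu> * tan \<theta>"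
    and int: "integrable halfline (\<lambda>t. exp (\<nu> * of_real t) * indicator {D / (2 * R)..D / R} t)"
  shows "exp (- D) * D / (4 * R) \<le>
    cmod (LINT t|halfline. exp (\<nu> * of_real t) * indicator {D / (2 * R)..D / R} t)"
proof -
  have tan: "0 < tan \<theta>" using \<theta> by (intro tan_gt_zero)
  then have D0: "0 < D" by (simp add: D)
  let ?A = "{D / (2 * R)..D / R}"
  have ind: "has_bochner_integral halfline (\<lambda>t. indicator ?A t) (D / R - D / (2 * R))"
    using D0 R by (intro has_bochner_integral_halfline_indicator) (auto simp: field_simps)
  have Re_ge: "exp (- D) / 2 * indicator ?A t \<le> Re (exp (\<nu> * of_real t) * indicator ?A t)" for t
  proof (cases "t \<in> ?A")
    case True
    moreover have "0 < D / (2 * R)" using D0 R by simp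
    ultimately have t: "0 \<le> t" "R * t \<le> D"
      using R by (auto simp: pos_le_divide_eq mult.commute)
    have "- Re \<nu> * t \<le> R * t" using \<nu> t by (intro mult_right_mono) auto
    with t have "exp (- D) \<le> exp (Re \<nu> * t)" by simp
    moreover have "1 / 2 \<le> cos (Im \<nu> * t)"
    proof -
      have "\<bar>Im \<nu> * t\<bar> \<le> - Re \<nu> * tan \<theta> * t"
        using mult_right_mono[OF \<nu>(3) t(1)] t by (simp add: abs_mult)
      also have "\<dots> \<le> tan \<theta> * (R * t)"
        using mult_left_mono[OF \<open>- Re \<nu> * t \<le> R * t\<close> less_imp_le[OF tan]] by (simp add: mult_ac)
      also have "\<dots> \<le> tan \<theta> * D" using tan t by (intro mult_left_mono) auto
      also have "\<dots> = pi / 3" using tan by (simp add: D)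
      finally have "cos (pi / 3) \<le> cos \<bar>Im \<nu> * t\<bar>"
        by (intro cos_monotone_0_pi_le) auto
      then show ?thesis by (simp add: cos_60)
    qed
    ultimately have "exp (- D) * (1 / 2) \<le> exp (Re \<nu> * t) * cos (Im \<nu> * t)"
      by (intro mult_mono) auto
    then show ?thesis using True by (simp add: Re_exp)
  qed simp
  have "exp (- D) * D / (4 * R) = (LINT t|halfline. exp (- D) / 2 * indicator ?A t)"
    using has_bochner_integral_integral_eq[OF ind] R by (simp add: field_simps)
  also have "\<dots> \<le> (LINT t|halfline. Re (exp (\<nu> * of_real t) * indicator ?A t))"
    using ind int Re_ge by (intro integral_mono integrable_Re) (auto simp: has_bochner_integral_iff)
  also have "\<dots> = Re (LINT t|halfline. exp (\<nu> * of_real t) * indicator ?A t)"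
    using int by (intro integral_Re)
  also have "\<dots> \<le> cmod (LINT t|halfline. exp (\<nu> * of_real t) * indicator ?A t)"
    by (rule complex_Re_le_cmod)
  finally show ?thesis .
qed

lemma weighted_Lp_indicator:
  fixes p \<alpha> D R :: real
  assumes p: "0 < p" and D: "0 < D" and R: "0 < R"
  defines "u \<equiv> \<lambda>t. indicator {D / (2 * R)..D / R} t :: complex"
  shows "u \<in> weighted_Lp p (\<lambda>t. t powr \<alpha>)"
    and "weighted_Lp_norm p (\<lambda>t. t powr \<alpha>) u powr p \<le> 2 powr \<bar>\<alpha>\<bar> * D powr (\<alpha> + 1) * R powr (- (\<alpha> + 1))"
proof -
  let ?A = "{D / (2 * R)..D / R}"
  let ?K = "2 powr \<bar>\<alpha>\<bar> * (D / R) powr \<alpha>"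
  have ind: "has_bochner_integral halfline (\<lambda>t. ?K * indicator ?A t) (?K * (D / R - D / (2 * R)))"
    using D R by (intro has_bochner_integral_mult_right has_bochner_integral_halfline_indicator) (auto simp: field_simps)
  have le: "cmod (u t) powr p * t powr \<alpha> \<le> ?K * indicator ?A t" for t
  proof (cases "t \<in> ?A")
    case True
    \<comment> \<open>On \<open>[1 / 2, 1]\<close> the power \<open>y powr \<alpha>\<close> is
      largest at \<open>1\<close> or at \<open>1 / 2\<close>, according to the sign of
      \<open>\<alpha>\<close>; the constant \<open>2 powr \<bar>\<alpha>\<bar>\<close> covers both
      cases.\<close>
    define y where "y = t / (D / R)"
    have y: "1 / 2 \<le> y" "y \<le> 1" "t = y * (D / R)"
      using True D R by (auto simp: y_def field_simps)
    have "y powr \<alpha> \<le> 2 powr \<bar>\<alpha>\<bar>"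
    proof (cases "0 \<le> \<alpha>")
      case True
      then have "y powr \<alpha> \<le> 1 powr \<alpha>" using y by (intro powr_mono2) auto
      also have "\<dots> \<le> 2 powr \<bar>\<alpha>\<bar>" by (simp add: ge_one_powr_ge_zero)
      finally show ?thesis .
    next
      case False
      then have "y powr \<alpha> \<le> (1 / 2) powr \<alpha>" using y by (intro powr_mono2') auto
      also have "\<dots> = 2 powr \<bar>\<alpha>\<bar>" using False by (simp add: powr_divide powr_minus divide_simps)
      finally show ?thesis .
    qed
    moreover have "t powr \<alpha> = y powr \<alpha> * (D / R) powr \<alpha>"
      unfolding y(3) by (rule powr_mult)
    ultimately have "t powr \<alpha> \<le> ?K"
      by (simp add: mult_right_mono)
    then show ?thesis using True by (simp add: u_def)
  qed (simp add: u_def)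
  have u: "u \<in> borel_measurable halfline" unfolding u_def by measurable
  have int: "integrable halfline (\<lambda>t. cmod (u t) powr p * t powr \<alpha>)"
  proof (rule Bochner_Integration.integrable_bound)
    show "integrable halfline (\<lambda>t. ?K * indicator ?A t)" using ind by (simp only: has_bochner_integral_iff)
    show "(\<lambda>t. cmod (u t) powr p * t powr \<alpha>) \<in> borel_measurable halfline"
      using u by measurable
    show "AE t in halfline. norm (cmod (u t) powr p * t powr \<alpha>) \<le> norm (?K * indicator ?A t)"
      using le by (intro AE_I2) (simp add: abs_mult)
  qed
  show "u \<in> weighted_Lp p (\<lambda>t. t powr \<alpha>)"
    using u int by (simp add: weighted_Lp_def)
  have "(LINT t|halfline. cmod (u t) powr p * t powr \<alpha>) \<le> (LINT t|halfline. ?K * indicator ?A t)"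
    using ind by (intro integral_mono int le) (simp only: has_bochner_integral_iff)
  also have "\<dots> = ?K * (D / R - D / (2 * R))"
    by (rule has_bochner_integral_integral_eq[OF ind])
  also have "\<dots> \<le> ?K * (D / R)"
    using D R by (intro mult_left_mono) (auto simp: field_simps)
  also have "\<dots> = 2 powr \<bar>\<alpha>\<bar> * (D / R) powr (\<alpha> + 1)"
    using D R by (simp add: powr_add)
  also have "(D / R) powr (\<alpha> + 1) = D powr (\<alpha> + 1) * R powr (- (\<alpha> + 1))"
    unfolding powr_minus_divide using D R by (simp add: powr_divide)
  finally show "weighted_Lp_norm p (\<lambda>t. t powr \<alpha>) u powr p \<le> 2 powr \<bar>\<alpha>\<bar> * D powr (\<alpha> + 1) * R powr (- (\<alpha> + 1))"
    using p by (simp add: weighted_Lp_norm_def powr_powr integral_nonneg_AE mult.assoc)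
qed

text \<open>For the test function at scale \<open>r\<close>, the lower Riesz bound makes the sum of
  the \<open>cmod (b k) powr q\<close> times \<open>(\<kappa> / r) powr q\<close> at most a constant
  times the \<open>q\<close>-th power of the weighted norm. That norm contributes
  \<open>r powr (- (\<alpha> + 1) * (q / p))\<close>, and the two powers of \<open>r\<close> combine
  to the required exponent.\<close>

lemma carleson_condition_necessary:
  fixes \<phi> :: "nat \<Rightarrow> 'a::complex_banach" and b \<mu> :: "nat \<Rightarrow> complex" and p q \<alpha> \<theta> m :: real
  assumes p: "1 < p" and pq: "p \<le> q" and \<phi>: "q_riesz_basis q \<phi>"
    and \<mu>: "\<And>k. Re (\<mu> k) < 0" and \<theta>: "0 < \<theta>" "\<theta> < pi / 2"
    and sector: "\<And>k. \<bar>Im (\<mu> k)\<bar> \<le> - Re (\<mu> k) * tan \<theta>"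
    and m: "0 < m"
    and adm: "\<And>u. u \<in> weighted_Lp p (\<lambda>t. t powr \<alpha>) \<Longrightarrow>
      \<exists>x. has_control_integral \<phi> \<mu> b u x \<and> norm x \<le> m * weighted_Lp_norm p (\<lambda>t. t powr \<alpha>) u"
  shows "\<exists>C>0. \<forall>F r. finite F \<longrightarrow> 0 < r \<longrightarrow>
    (\<Sum>k\<in>{k\<in>F. - Re (\<mu> k) \<le> r}. cmod (b k) powr q) \<le> C * r powr (q / p * (p - 1 - \<alpha>))"
proof -
  have q: "0 < q" using p pq by simp
  obtain c where c: "0 < c" and low: "\<And>a x n. (\<lambda>k. a k *\<^sub>C \<phi> k) sums x \<Longrightarrow>
      c * (\<Sum>k<n. cmod (a k) powr q) \<le> norm x powr q"
    using q_riesz_basis_lower[OF \<phi> q] by blast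
  define D where "D = pi / (3 * tan \<theta>)"
  have D: "0 < D" using tan_gt_zero[OF \<theta>] by (simp add: D_def)
  define \<kappa> where "\<kappa> = exp (- D) * D / 4"
  have \<kappa>: "0 < \<kappa>" using D by (simp add: \<kappa>_def)
  define N where "N = 2 powr \<bar>\<alpha>\<bar> * D powr (\<alpha> + 1)"
  have N: "0 < N" using D by (simp add: N_def)
  define C where "C = m powr q * N powr (q / p) / (c * \<kappa> powr q)"
  have C: "0 < C" using m N c \<kappa> by (simp add: C_def)
  have "(\<Sum>k\<in>{k\<in>F. - Re (\<mu> k) \<le> r}. cmod (b k) powr q) \<le> C * r powr (q / p * (p - 1 - \<alpha>))"
    if F: "finite F" and r: "0 < r" for F r
  proof -
    define G where "G = {k\<in>F. - Re (\<mu> k) \<le> r}"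
    have G: "finite G" using F by (simp add: G_def)
    then obtain n where n: "G \<subseteq> {..<n}" using finite_nat_iff_bounded by blast
    define u :: "real \<Rightarrow> complex" where "u t = indicator {D / (2 * r)..D / r} t" for t
    have u: "u \<in> weighted_Lp p (\<lambda>t. t powr \<alpha>)"
      "weighted_Lp_norm p (\<lambda>t. t powr \<alpha>) u powr p \<le> N * r powr (- (\<alpha> + 1))"
      using weighted_Lp_indicator[of p D r \<alpha>] p D r unfolding u_def[abs_def] N_def by auto
    obtain x where x: "has_control_integral \<phi> \<mu> b u x"
      "norm x \<le> m * weighted_Lp_norm p (\<lambda>t. t powr \<alpha>) u"
      using adm[OF u(1)] by blast
    define I where "I k = (LINT t|halfline. exp (\<mu> k * of_real t) * u t)" for k
    have I_ge: "\<kappa> / r \<le> cmod (I k)" if "k \<in> G" for k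
      using cmod_laplace_indicator_ge[OF \<theta> D_def r \<mu> _ sector, of k] x(1) that
      by (simp add: has_control_integral_def I_def u_def G_def \<kappa>_def)
    have "(\<Sum>k\<in>G. cmod (b k) powr q) * (\<kappa> / r) powr q \<le> (\<Sum>k\<in>G. cmod (b k * I k) powr q)"
      unfolding sum_distrib_right
    proof (rule sum_mono)
      fix k assume "k \<in> G"
      then have "(\<kappa> / r) powr q \<le> cmod (I k) powr q"
        using I_ge \<kappa> r p pq by (intro powr_mono2) auto
      then show "cmod (b k) powr q * (\<kappa> / r) powr q \<le> cmod (b k * I k) powr q"
        by (simp add: norm_mult powr_mult mult_left_mono)
    qed
    also have "\<dots> \<le> (\<Sum>k<n. cmod (b k * I k) powr q)"
      using n by (intro sum_mono2) auto
    also have "\<dots> \<le> norm x powr q / c"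
      using low[of "\<lambda>k. b k * I k" x n] x(1) c
      by (simp add: has_control_integral_def I_def field_simps)
    also have "\<dots> \<le> (m powr q * N powr (q / p) * r powr (- (\<alpha> + 1) * (q / p))) / c"
    proof -
      have nn: "0 \<le> weighted_Lp_norm p (\<lambda>t. t powr \<alpha>) u" by (simp add: weighted_Lp_norm_def)
      have "norm x powr q \<le> (m * weighted_Lp_norm p (\<lambda>t. t powr \<alpha>) u) powr q"
        using x(2) p pq by (intro powr_mono2) auto
      also have "\<dots> = m powr q * (weighted_Lp_norm p (\<lambda>t. t powr \<alpha>) u powr p) powr (q / p)"
        using m nn p by (simp add: powr_mult powr_powr)
      also have "\<dots> \<le> m powr q * (N * r powr (- (\<alpha> + 1))) powr (q / p)"
        using u(2) p pq by (intro mult_left_mono powr_mono2) auto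
      also have "\<dots> = m powr q * N powr (q / p) * r powr (- (\<alpha> + 1) * (q / p))"
        using N by (simp add: powr_mult powr_powr)
      finally show ?thesis using c by (intro divide_right_mono) auto
    qed
    finally have "(\<Sum>k\<in>G. cmod (b k) powr q) \<le>
        (m powr q * N powr (q / p) * r powr (- (\<alpha> + 1) * (q / p))) / c / (\<kappa> / r) powr q"
      using \<kappa> r by (subst pos_le_divide_eq) auto
    also have "\<dots> = C * (r powr q * r powr (- (\<alpha> + 1) * (q / p)))"
      using \<kappa> r by (simp add: C_def powr_divide)
    also have "r powr q * r powr (- (\<alpha> + 1) * (q / p)) = r powr (q / p * (p - 1 - \<alpha>))"
    proof -
      have "q + - (\<alpha> + 1) * (q / p) = q / p * (p - 1 - \<alpha>)"
        using p by (simp add: field_simps)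
      then show ?thesis by (simp only: flip: powr_add)
    qed
    finally show ?thesis by (simp add: G_def)
  qed
  with C show ?thesis by blast
qed

text \<open>The modulus of each coordinate integral is at most the Laplace transform of
  \<open>cmod (u t)\<close> at \<open>- Re (\<mu> k)\<close>. The uniform bound on finite sums
  places the coefficients in the sequence space, and the upper Riesz bound produces the
  vector.\<close>

lemma admissible_if_carleson_condition:
  fixes \<phi> :: "nat \<Rightarrow> 'a::complex_banach" and b \<mu> :: "nat \<Rightarrow> complex" and p q \<alpha> C :: real
  assumes p: "1 < p" and pq: "p \<le> q" and \<alpha>: "\<alpha> < p - 1" and \<phi>: "q_riesz_basis q \<phi>"
    and \<mu>: "\<And>k. Re (\<mu> k) < 0" and C: "0 < C"
    and growth: "\<And>F r. finite F \<Longrightarrow> 0 < r \<Longrightarrow>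
      (\<Sum>k\<in>{k\<in>F. - Re (\<mu> k) \<le> r}. cmod (b k) powr q) \<le> C * r powr (q / p * (p - 1 - \<alpha>))"
  shows "\<exists>m>0. \<forall>u\<in>weighted_Lp p (\<lambda>t. t powr \<alpha>).
    \<exists>x. has_control_integral \<phi> \<mu> b u x \<and> norm x \<le> m * weighted_Lp_norm p (\<lambda>t. t powr \<alpha>) u"
proof -
  have q: "0 < q" using p pq by simp
  have b: "0 \<le> cmod (b k) powr q" and x: "0 < - Re (\<mu> k)" for k
    using \<mu>[of k] by auto
  obtain K where K: "0 \<le> K" and bound: "\<And>v F. v \<in> borel_measurable halfline \<Longrightarrow> (\<And>t. 0 \<le> v t) \<Longrightarrow>
      integrable halfline (\<lambda>t. v t powr p * t powr \<alpha>) \<Longrightarrow> finite F \<Longrightarrow>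
      (\<Sum>k\<in>F. cmod (b k) powr q * (LINT t|halfline. exp (- (- Re (\<mu> k) * t)) * v t) powr q) \<le>
        K * (LINT t|halfline. v t powr p * t powr \<alpha>) powr (q / p)"
    using weighted_laplace_bound[OF p pq \<alpha> less_imp_le[OF C] b x growth] by blast
  obtain C' where C': "C' > 0" and riesz_all: "\<forall>a :: nat \<Rightarrow> complex. summable (\<lambda>k. cmod (a k) powr q) \<longrightarrow>
      summable (\<lambda>k. a k *\<^sub>C \<phi> k) \<and>
      norm (\<Sum>k. a k *\<^sub>C \<phi> k) powr q \<le> C' * (\<Sum>k. cmod (a k) powr q)"
    using \<phi> unfolding q_riesz_basis_def by auto
  note riesz = riesz_all[rule_format]
  \<comment> \<open>\<open>K\<close> may be \<open>0\<close>; adding \<open>1\<close> makes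
    \<open>m\<close> positive.\<close>
  define m where "m = (C' * (K + 1)) powr (1 / q)"
  have m: "0 < m" using C' K by (simp add: m_def)
  have "\<exists>x. has_control_integral \<phi> \<mu> b u x \<and> norm x \<le> m * weighted_Lp_norm p (\<lambda>t. t powr \<alpha>) u"
    if u: "u \<in> weighted_Lp p (\<lambda>t. t powr \<alpha>)" for u
  proof -
    have [measurable]: "u \<in> borel_measurable halfline"
      and int: "integrable halfline (\<lambda>t. cmod (u t) powr p * t powr \<alpha>)"
      using u by (auto simp: weighted_Lp_def)
    define W where "W = (LINT t|halfline. cmod (u t) powr p * t powr \<alpha>)"
    have W: "0 \<le> W" by (auto simp: W_def intro: integral_nonneg_AE)
    define I where "I k = (LINT t|halfline. exp (\<mu> k * of_real t) * u t)" for k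
    have abs_int: "integrable halfline (\<lambda>t. exp (- (- Re (\<mu> k) * t)) * cmod (u t))" for k
    proof (rule laplace_transform_powr_le(1)[OF p \<alpha>])
      show "integrable halfline (\<lambda>t. exp (- (- Re (\<mu> k) * t)) * (cmod (u t) powr p * t powr \<alpha>))"
      proof (rule Bochner_Integration.integrable_bound[OF int])
        show "AE t in halfline. norm (exp (- (- Re (\<mu> k) * t)) * (cmod (u t) powr p * t powr \<alpha>)) \<le>
            norm (cmod (u t) powr p * t powr \<alpha>)"
          using \<mu>[of k] by (intro AE_I2) (auto intro!: mult_left_le_one_le simp: mult_nonpos_nonneg)
      qed measurable
    qed (use \<mu> in auto)
    have norm_eq: "norm (exp (\<mu> k * of_real t) * u t) = exp (- (- Re (\<mu> k) * t)) * cmod (u t)" for k t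
      by (simp add: norm_mult)
    have exp_meas: "(\<lambda>t. exp (\<mu> k * of_real t) * u t) \<in> borel_measurable halfline" for k
      by measurable
    have u_int: "integrable halfline (\<lambda>t. exp (\<mu> k * of_real t) * u t)" for k
      using Bochner_Integration.integrable_bound[OF abs_int[of k] exp_meas[of k]] norm_eq by simp
    have I_le: "cmod (I k) \<le> (LINT t|halfline. exp (- (- Re (\<mu> k) * t)) * cmod (u t))" for k
      unfolding I_def norm_eq[symmetric] by (rule integral_norm_bound)
    have partial: "(\<Sum>k<n. cmod (b k * I k) powr q) \<le> K * W powr (q / p)" for n
    proof -
      have "(\<Sum>k<n. cmod (b k * I k) powr q) \<le>
          (\<Sum>k<n. cmod (b k) powr q * (LINT t|halfline. exp (- (- Re (\<mu> k) * t)) * cmod (u t)) powr q)"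
        using I_le q by (intro sum_mono) (auto simp: norm_mult powr_mult intro!: mult_left_mono powr_mono2)
      also have "\<dots> \<le> K * W powr (q / p)"
        unfolding W_def using int by (intro bound) auto
      finally show ?thesis .
    qed
    have sum: "summable (\<lambda>k. cmod (b k * I k) powr q)"
      by (rule summableI_nonneg_bounded[OF _ partial]) simp
    define x where "x = (\<Sum>k. (b k * I k) *\<^sub>C \<phi> k)"
    have "has_control_integral \<phi> \<mu> b u x"
      using u_int riesz[OF sum] unfolding has_control_integral_def x_def I_def[symmetric]
      by (auto intro: summable_sums)
    moreover have "norm x \<le> m * weighted_Lp_norm p (\<lambda>t. t powr \<alpha>) u"
    proof -
      have "norm x powr q \<le> C' * (\<Sum>k. cmod (b k * I k) powr q)"
        using riesz[OF sum] by (simp add: x_def)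
      also have "\<dots> \<le> C' * (K * W powr (q / p))"
        using C' by (intro mult_left_mono suminf_le_const[OF sum partial]) auto
      also have "\<dots> \<le> C' * (K + 1) * W powr (q / p)"
        using C' by (simp add: algebra_simps)
      finally have "(norm x powr q) powr (1 / q) \<le> (C' * (K + 1) * W powr (q / p)) powr (1 / q)"
        using q by (intro powr_mono2) auto
      then show ?thesis
        using q C' K p by (simp add: powr_powr powr_mult m_def weighted_Lp_norm_def W_def)
    qed
    ultimately show ?thesis by blast
  qed
  with m show ?thesis by blast
qed

theorem corollary3:
  fixes p q p' \<alpha> \<theta> :: real
    and T :: "real \<Rightarrow> 'a::complex_banach \<Rightarrow> 'a"
    and \<phi> :: "nat \<Rightarrow> 'a"
    and \<mu> b :: "nat \<Rightarrow> complex"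
    and \<beta> :: complex
    and J :: "'a \<Rightarrow> 'y::complex_banach"
    and B :: "complex \<Rightarrow> 'y"
  assumes "1 < p" and "p \<le> q" and "p' = p / (p - 1)" and "\<alpha> < p - 1"
    and "C0_semigroup T"
    and "q_riesz_basis q \<phi>"
    and "\<And>k t. t \<ge> 0 \<Longrightarrow> T t (\<phi> k) = exp (\<mu> k * of_real t) *\<^sub>C \<phi> k"
    and "\<And>k. Re (\<mu> k) < 0"
    and "extrapolation_space T \<beta> J"
    and "bounded_clinear B"
    and "corresponds_to J \<phi> B b"
    and "0 < \<theta>" and "\<theta> < pi / 2"
    and "\<And>k. \<bar>Im (- \<mu> k)\<bar> < Re (- \<mu> k) * tan \<theta>"
  shows "Lp_admissible \<phi> \<mu> J p (\<lambda>t. t powr \<alpha>) B \<longleftrightarrow>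
    (\<exists>C>0. \<forall>\<Gamma> :: nat set. \<Gamma> \<noteq> {} \<longrightarrow>
      (\<Sum>\<^sub>\<infinity>k\<in>\<Gamma>. ennreal (cmod (b k) powr q))
        \<le> ennreal C * (SUP k\<in>\<Gamma>. ennreal (Re (- \<mu> k) powr (q / p' * (1 - \<alpha> / (p - 1))))))"
proof -
  note p = assms(1) and pq = assms(2) and \<alpha> = assms(4) and \<phi> = assms(6)
  have \<mu>: "0 < Re (- \<mu> k)" for k using assms(8)[of k] by simp
  have basis: "schauder_basis \<phi>" using \<phi> by (simp add: q_riesz_basis_def)
  \<comment> \<open>Substitute \<open>1 / p' = (p - 1) / p\<close> and cancel
    \<open>p - 1\<close>.\<close>
  have exponent: "q / p' * (1 - \<alpha> / (p - 1)) = q / p * (p - 1 - \<alpha>)"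
    using assms(1,3) by (simp add: field_simps)
  have exponent_pos: "0 < q / p * (p - 1 - \<alpha>)"
    using p pq \<alpha> by simp
  \<comment> \<open>Uniqueness of the representing sequence replaces the existentially quantified
    one by the given \<open>b\<close>.\<close>
  have "Lp_admissible \<phi> \<mu> J p (\<lambda>t. t powr \<alpha>) B \<longleftrightarrow>
      (\<exists>m>0. \<forall>u\<in>weighted_Lp p (\<lambda>t. t powr \<alpha>). \<exists>x. has_control_integral \<phi> \<mu> b u x \<and>
        norm x \<le> m * weighted_Lp_norm p (\<lambda>t. t powr \<alpha>) u)"
    using corresponds_to_unique[OF basis assms(7,9,11)] assms(11)
    unfolding Lp_admissible_def by blast
  also have "\<dots> \<longleftrightarrow> (\<exists>C>0. \<forall>F r. finite F \<longrightarrow> 0 < r \<longrightarrow>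
      (\<Sum>k\<in>{k\<in>F. - Re (\<mu> k) \<le> r}. cmod (b k) powr q) \<le> C * r powr (q / p * (p - 1 - \<alpha>)))"
    (is "?adm \<longleftrightarrow> ?carleson")
  proof
    assume ?adm
    then obtain m where m: "0 < m" and adm: "\<forall>u\<in>weighted_Lp p (\<lambda>t. t powr \<alpha>).
        \<exists>x. has_control_integral \<phi> \<mu> b u x \<and> norm x \<le> m * weighted_Lp_norm p (\<lambda>t. t powr \<alpha>) u"
      by blast
    have sector: "\<bar>Im (\<mu> k)\<bar> \<le> - Re (\<mu> k) * tan \<theta>" for k
      using assms(14)[of k] by simp
    show ?carleson
      by (rule carleson_condition_necessary[OF p pq \<phi> assms(8) assms(12,13) sector m bspec[OF adm]])
  next
    assume ?carleson
    then obtain C where C: "0 < C" and growth: "\<forall>F r. finite F \<longrightarrow> 0 < r \<longrightarrow>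
        (\<Sum>k\<in>{k\<in>F. - Re (\<mu> k) \<le> r}. cmod (b k) powr q) \<le> C * r powr (q / p * (p - 1 - \<alpha>))"
      by blast
    show ?adm
      by (rule admissible_if_carleson_condition[OF p pq \<alpha> \<phi> assms(8) C growth[rule_format]])
  qed
  also have "\<dots> \<longleftrightarrow> (\<exists>C>0. \<forall>\<Gamma> :: nat set. \<Gamma> \<noteq> {} \<longrightarrow>
      (\<Sum>\<^sub>\<infinity>k\<in>\<Gamma>. ennreal (cmod (b k) powr q))
        \<le> ennreal C * (SUP k\<in>\<Gamma>. ennreal (Re (- \<mu> k) powr (q / p' * (1 - \<alpha> / (p - 1))))))"
    using carleson_condition_iff[of "\<lambda>k. cmod (b k) powr q" "\<lambda>k. Re (- \<mu> k)", OF _ \<mu> exponent_pos]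
    unfolding exponent by simp
  finally show ?thesis .
qed

end
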